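(* Let $p$ be a prime, let $s$ be a positive integer, and let $M=p^s$. For any $i,j\in\mathbb{Z}$ satisfying $0\le j<i<M$, there exists $u(x)\in\mathbb{Z}[x]/\Phi_M(x)$ such that $(x^i-x^j)\cdot u(x)=p \pmod{\Phi_M(x)}$ and $\|u(x)\|_\infty\le p-1$.
   Context: $\Phi_M(x)$ denotes the $M$th cyclotomic polynomial, of degree $\phi(M)$ (Euler's totient). $\mathbb{Z}[x]/\Phi_M(x)$ is the quotient of $\mathbb{Z}[x]$ by the ideal generated by $\Phi_M(x)$. For $g\in\mathbb{Z}[x]/\Phi_M(x)$, $\|g\|_\infty$ is the largest absolute value of the coefficients of the unique representative of $g$ in $\mathbb{Z}[x]$ of degree less than $\phi(M)$. *)

theory Defs
  imports
    "HOL-Algebra.QuotRing"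
    "HOL-Computational_Algebra.Polynomial"
    "HOL-Number_Theory.Totient"
    "HOL-Decision_Procs.Algebra_Aux"
begin

definition primitive_roots_unity :: "nat \<Rightarrow> complex set"
  where "primitive_roots_unity n = {z. z ^ n = 1 \<and> (\<forall>k. 0 < k \<and> k < n \<longrightarrow> z ^ k \<noteq> 1)}"

text \<open>
  The integer polynomial exists for \<open>n > 0\<close> by \<open>of_int_cyclotomic\<close> below;
  the value at \<open>0\<close> is irrelevant.
\<close>

definition cyclotomic :: "nat \<Rightarrow> int poly"
  where "cyclotomic n =
    (THE p. map_poly of_int p = (\<Prod>z\<in>primitive_roots_unity n. [:- z, 1:]))"

text \<open>
  \<open>cring_class_ops\<close> packages the type class operations on \<^typ>\<open>int poly\<close> as a ring
  record with carrier \<^term>\<open>UNIV\<close>.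
\<close>

definition int_poly_ring :: "int poly ring"
  where "int_poly_ring = cring_class_ops"

definition cyclotomic_ideal :: "nat \<Rightarrow> int poly set"
  where "cyclotomic_ideal n = Idl\<^bsub>int_poly_ring\<^esub> {cyclotomic n}"

definition cyclotomic_ring :: "nat \<Rightarrow> int poly set ring"
  where "cyclotomic_ring n = int_poly_ring Quot cyclotomic_ideal n"

definition residue_class :: "nat \<Rightarrow> int poly \<Rightarrow> int poly set"
  where "residue_class n f = cyclotomic_ideal n +>\<^bsub>int_poly_ring\<^esub> f"

text \<open>
  For \<open>n > 0\<close> the degree of \<^term>\<open>cyclotomic n\<close> is \<^term>\<open>totient n\<close>, and each residue
  class has exactly one such representative (\<open>cyclotomic_monic\<close>, \<open>ex1_reduced_rep\<close>).
\<close>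

definition reduced_rep :: "nat \<Rightarrow> int poly set \<Rightarrow> int poly"
  where "reduced_rep n g = (THE r. r \<in> g \<and> degree r < totient n)"

definition inf_norm :: "nat \<Rightarrow> int poly set \<Rightarrow> int"
  where "inf_norm n g = Max ((\<lambda>k. \<bar>coeff (reduced_rep n g) k\<bar>) ` {..<totient n})"


subsection \<open>Well-definedness\<close>

lemma map_poly_of_int_mult:
  "map_poly of_int (p * q) = map_poly of_int p * (map_poly of_int q :: complex poly)"
  by (rule poly_eqI) (simp add: coeff_map_poly coeff_mult)

lemma map_poly_of_int_add:
  "map_poly of_int (p + q) = map_poly of_int p + (map_poly of_int q :: complex poly)"
  by (rule poly_eqI) (simp add: coeff_map_poly)

lemma map_poly_of_int_prod:
  "map_poly of_int (prod f A) = (\<Prod>x\<in>A. map_poly of_int (f x) :: complex poly)"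
  by (induction A rule: infinite_finite_induct) (simp_all add: map_poly_of_int_mult)

lemma map_poly_of_int_inject:
  "map_poly of_int p = (map_poly of_int q :: complex poly) \<longleftrightarrow> p = q"
  by (auto simp: poly_eq_iff coeff_map_poly)

lemma degree_map_poly_of_int: "degree (map_poly of_int p :: complex poly) = degree p"
  by (rule degree_map_poly) auto

lemma finite_primitive_roots_unity: "n > 0 \<Longrightarrow> finite (primitive_roots_unity n)"
  by (rule finite_subset[of _ "{z. z ^ n = 1}"])
     (auto simp: primitive_roots_unity_def finite_roots_unity)

lemma primitive_roots_unity_disjoint:
  assumes "m > 0" "n > 0" "m \<noteq> n"
  shows "primitive_roots_unity m \<inter> primitive_roots_unity n = {}"
  using assms unfolding primitive_roots_unity_def by (cases m n rule: linorder_cases) auto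

lemma roots_unity_eq_Union:
  assumes "n > 0"
  shows "{z::complex. z ^ n = 1} = (\<Union>d\<in>{d. d dvd n}. primitive_roots_unity d)"
proof (intro equalityI subsetI)
  fix z :: complex assume "z \<in> {z. z ^ n = 1}"
  hence zn: "z ^ n = 1" by simp
  define d where "d = (LEAST k. k > 0 \<and> z ^ k = 1)"
  have d: "d > 0 \<and> z ^ d = 1"
    unfolding d_def by (rule LeastI[of _ n]) (use assms zn in auto)
  have least: "z ^ k \<noteq> 1" if "0 < k" "k < d" for k
    using not_less_Least[of k "\<lambda>k. k > 0 \<and> z ^ k = 1"] that unfolding d_def by auto
  have "z ^ n = z ^ (d * (n div d) + n mod d)" by simp
  also have "\<dots> = (z ^ d) ^ (n div d) * z ^ (n mod d)" by (simp only: power_add power_mult)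
  finally have "z ^ (n mod d) = 1" using zn d by simp
  moreover have "n mod d < d" using d by simp
  ultimately have "n mod d = 0" using least by blast
  hence "d dvd n" by auto
  thus "z \<in> (\<Union>d\<in>{d. d dvd n}. primitive_roots_unity d)"
    using d least by (auto simp: primitive_roots_unity_def)
next
  fix z :: complex assume "z \<in> (\<Union>d\<in>{d. d dvd n}. primitive_roots_unity d)"
  thus "z \<in> {z. z ^ n = 1}"
    by (auto simp: primitive_roots_unity_def elim!: dvdE) (simp add: power_mult)
qed

lemma card_primitive_roots_unity:
  assumes "n > 0"
  shows "card (primitive_roots_unity n) = totient n"
  using assms
proof (induction n rule: less_induct)
  case (less n)
  let ?D = "{d. d dvd n} - {n}"
  have fin: "finite {d. d dvd n}" using less.prems by simp
  have pos: "d > 0" if "d dvd n" for d using that less.prems dvd_pos_nat by blast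
  have proper: "d < n \<and> d > 0" if "d \<in> ?D" for d
    using that pos dvd_imp_le[OF _ less.prems] le_neq_implies_less[of d n] by blast
  have "n = card {z::complex. z ^ n = 1}" using card_roots_unity_eq less.prems by simp
  also have "\<dots> = (\<Sum>d | d dvd n. card (primitive_roots_unity d))"
    unfolding roots_unity_eq_Union[OF less.prems]
    by (rule card_UN_disjoint)
       (use fin pos finite_primitive_roots_unity primitive_roots_unity_disjoint in auto)
  also have "\<dots> = card (primitive_roots_unity n) + (\<Sum>d\<in>?D. card (primitive_roots_unity d))"
    by (rule sum.remove) (use fin in auto)
  also have "(\<Sum>d\<in>?D. card (primitive_roots_unity d)) = (\<Sum>d\<in>?D. totient d)"
    by (rule sum.cong[OF refl], rule less.IH)
       (use proper in blast)+
  finally have "n = card (primitive_roots_unity n) + (\<Sum>d\<in>?D. totient d)" .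
  moreover have "n = totient n + (\<Sum>d\<in>?D. totient d)"
    using totient_divisor_sum[of n] sum.remove[OF fin, of n totient] by simp
  ultimately show ?case by linarith
qed

lemma prod_roots_unity:
  assumes "n > 0"
  shows "(\<Prod>z\<in>{z::complex. z ^ n = 1}. [:- z, 1:]) = monom 1 n - 1"
proof -
  let ?R = "{z::complex. z ^ n = 1}"
  let ?P = "\<Prod>z\<in>?R. [:- z, 1:]"
  let ?Q = "monom 1 n - 1 :: complex poly"
  have degP: "degree ?P = n"
    using assms by (subst degree_prod_sum_eq) (auto simp: card_roots_unity_eq)
  have lcP: "coeff ?P n = 1"
    using lead_coeff_prod[of "\<lambda>z::complex. [:- z, 1:]" ?R] degP by simp
  have "degree (?P - ?Q) \<le> n"
    by (intro degree_diff_le) (use degP degree_monom_le in auto)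
  moreover have "coeff (?P - ?Q) n = 0" using lcP assms by simp
  ultimately have deg: "?P - ?Q = 0 \<or> degree (?P - ?Q) < n"
    using assms by (metis leading_coeff_0_iff le_neq_implies_less)
  show ?thesis
  proof (rule ccontr)
    assume "?P \<noteq> ?Q"
    hence nz: "?P - ?Q \<noteq> 0" by simp
    have "?R \<subseteq> {z. poly (?P - ?Q) z = 0}"
    proof
      fix z assume "z \<in> ?R"
      thus "z \<in> {z. poly (?P - ?Q) z = 0}"
        using finite_roots_unity[of n] assms
        by (auto simp: poly_prod poly_monom intro!: prod_zero bexI[of _ z])
    qed
    hence "card ?R \<le> degree (?P - ?Q)"
      using card_poly_roots_bound[OF nz] poly_roots_finite[OF nz] card_mono le_trans by blast
    thus False using deg nz assms by (simp add: card_roots_unity_eq)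
  qed
qed

lemma monic_dvd_of_int_poly:
  fixes A :: "int poly" and C :: "complex poly"
  assumes monic: "lead_coeff B = 1" and eq: "map_poly of_int A = map_poly of_int B * C"
  shows "\<exists>p. map_poly of_int p = C"
proof -
  obtain q r where qr: "pseudo_divmod A B = (q, r)" by fastforce
  have B0: "B \<noteq> 0" using monic by auto
  have A: "A = B * q + r" using pseudo_divmod(1)[OF B0 qr] monic by simp
  let ?h = "map_poly of_int :: int poly \<Rightarrow> complex poly"
  have *: "?h B * (C - ?h q) = ?h r"
    using eq unfolding A by (simp add: map_poly_of_int_mult map_poly_of_int_add algebra_simps)
  have "C - ?h q = 0"
  proof (rule ccontr)
    assume nz: "C - ?h q \<noteq> 0"
    have hB: "?h B \<noteq> 0" using B0 map_poly_of_int_inject[of B 0] by simp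
    have "r \<noteq> 0" using * nz hB by auto
    hence "degree r < degree B" using pseudo_divmod(2)[OF B0 qr] by simp
    moreover have "degree r = degree B + degree (C - ?h q)"
      using arg_cong[OF *, of degree] nz hB
      by (simp add: degree_mult_eq degree_map_poly_of_int)
    ultimately show False by simp
  qed
  thus ?thesis by auto
qed

lemma of_int_cyclotomic:
  assumes "n > 0"
  shows "map_poly of_int (cyclotomic n) = (\<Prod>z\<in>primitive_roots_unity n. [:- z, 1:])"
proof -
  have "\<exists>p. map_poly of_int p = (\<Prod>z\<in>primitive_roots_unity n. [:- z, 1:])"
    using assms
  proof (induction n rule: less_induct)
    case (less n)
    let ?D = "{d. d dvd n} - {n}"
    let ?F = "\<lambda>d. \<Prod>z\<in>primitive_roots_unity d. [:- z, 1:]"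
    have fin: "finite {d. d dvd n}" using less.prems by simp
    have pos: "d > 0" if "d dvd n" for d using that less.prems dvd_pos_nat by blast
    have proper: "d < n \<and> d > 0" if "d \<in> ?D" for d
      using that pos dvd_imp_le[OF _ less.prems] le_neq_implies_less[of d n] by blast
    have "\<forall>d\<in>?D. \<exists>p. map_poly of_int p = ?F d"
      by (intro ballI less.IH)
         (use proper in blast)+
    then obtain f where f: "\<And>d. d \<in> ?D \<Longrightarrow> map_poly of_int (f d) = ?F d" by metis
    define B where "B = prod f ?D"
    have hB: "map_poly of_int B = prod ?F ?D"
      unfolding B_def map_poly_of_int_prod by (rule prod.cong) (use f in auto)
    have "lead_coeff (map_poly of_int B :: complex poly) = 1"
      unfolding hB by (simp add: lead_coeff_prod)
    hence monic: "lead_coeff B = 1"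
      by (simp add: degree_map_poly_of_int coeff_map_poly)
    have "map_poly of_int (monom 1 n - 1 :: int poly) = (monom 1 n - 1 :: complex poly)"
      by (rule poly_eqI) (simp add: coeff_map_poly)
    also have "\<dots> = (\<Prod>z\<in>(\<Union>d\<in>{d. d dvd n}. primitive_roots_unity d). [:- z, 1:])"
      using prod_roots_unity[OF less.prems] roots_unity_eq_Union[OF less.prems] by simp
    also have "\<dots> = prod ?F {d. d dvd n}"
      by (rule prod.UNION_disjoint)
         (use fin pos finite_primitive_roots_unity primitive_roots_unity_disjoint in auto)
    also have "\<dots> = ?F n * prod ?F ?D" by (rule prod.remove) (use fin in auto)
    finally have "map_poly of_int (monom 1 n - 1 :: int poly) = map_poly of_int B * ?F n"
      by (simp add: hB mult.commute)
    thus ?case by (rule monic_dvd_of_int_poly[OF monic])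
  qed
  then obtain p where p: "map_poly of_int p = (\<Prod>z\<in>primitive_roots_unity n. [:- z, 1:])" ..
  show ?thesis unfolding cyclotomic_def
    by (rule theI[of _ p]) (use p in \<open>auto simp flip: map_poly_of_int_inject\<close>)
qed

lemma cyclotomic_monic:
  assumes "n > 0"
  shows "lead_coeff (cyclotomic n) = 1" "degree (cyclotomic n) = totient n"
proof -
  let ?F = "\<Prod>z\<in>primitive_roots_unity n. [:- z, 1:]"
  have "degree ?F = totient n"
    by (subst degree_prod_sum_eq) (auto simp: card_primitive_roots_unity[OF assms])
  thus deg: "degree (cyclotomic n) = totient n"
    using degree_map_poly_of_int of_int_cyclotomic[OF assms] by metis
  have "lead_coeff ?F = 1" by (simp add: lead_coeff_prod)
  thus "lead_coeff (cyclotomic n) = 1"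
    unfolding of_int_cyclotomic[OF assms, symmetric]
    by (simp add: degree_map_poly_of_int coeff_map_poly)
qed

lemma cring_int_poly_ring: "cring int_poly_ring"
  unfolding int_poly_ring_def by (rule cring_class)

lemma cyclotomic_ideal_eq: "cyclotomic_ideal n = {f. cyclotomic n dvd f}"
proof -
  interpret cring int_poly_ring by (rule cring_int_poly_ring)
  have "cyclotomic_ideal n = PIdl\<^bsub>int_poly_ring\<^esub> (cyclotomic n)"
    unfolding cyclotomic_ideal_def
    by (rule cgenideal_eq_genideal[symmetric]) (simp add: int_poly_ring_def carrier_class)
  thus ?thesis
    by (auto simp: cgenideal_def int_poly_ring_def carrier_class times_class dvd_def mult.commute)
qed

lemma mem_residue_class_iff: "g \<in> residue_class n f \<longleftrightarrow> cyclotomic n dvd g - f"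
proof
  assume "g \<in> residue_class n f"
  thus "cyclotomic n dvd g - f"
    by (auto simp: residue_class_def a_r_coset_def' cyclotomic_ideal_eq int_poly_ring_def plus_class)
next
  assume "cyclotomic n dvd g - f"
  thus "g \<in> residue_class n f"
    by (auto simp: residue_class_def a_r_coset_def' cyclotomic_ideal_eq int_poly_ring_def plus_class
             intro!: exI[of _ "g - f"])
qed

lemma carrier_cyclotomic_ring: "carrier (cyclotomic_ring n) = range (residue_class n)"
  by (auto simp: cyclotomic_ring_def FactRing_def A_RCOSETS_def' residue_class_def
      int_poly_ring_def carrier_class)

lemma ex1_reduced_rep:
  assumes "n > 0" "g \<in> carrier (cyclotomic_ring n)"
  shows "\<exists>!r. r \<in> g \<and> degree r < totient n"
proof -
  let ?C = "cyclotomic n"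
  note C = cyclotomic_monic[OF assms(1)]
  have C0: "?C \<noteq> 0" using C by auto
  obtain f where g: "g = residue_class n f" using assms(2) by (auto simp: carrier_cyclotomic_ring)
  obtain q r where qr: "pseudo_divmod f ?C = (q, r)" by fastforce
  have f: "f = ?C * q + r" using pseudo_divmod(1)[OF C0 qr] C by simp
  have "degree r < totient n"
    using pseudo_divmod(2)[OF C0 qr] C assms(1) by auto
  moreover have "r \<in> g" unfolding g mem_residue_class_iff by (simp add: f)
  moreover have "r1 = r2"
    if "r1 \<in> g" "degree r1 < totient n" "r2 \<in> g" "degree r2 < totient n" for r1 r2
  proof -
    have "?C dvd (r1 - f) - (r2 - f)"
      using that by (auto simp only: g mem_residue_class_iff intro: dvd_diff)
    hence "?C dvd r1 - r2" by simp
    moreover have "degree (r1 - r2) < degree ?C" using that C by (simp add: degree_diff_less)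
    ultimately have "r1 - r2 = 0" using dvd_imp_degree_le by fastforce
    thus ?thesis by simp
  qed
  ultimately show ?thesis by blast
qed

end

theory Submission
  imports Defs
begin

text \<open>
  Let \<open>z\<close> be a primitive \<open>M\<close>-th root of unity, \<open>d = i - j\<close>, \<open>m = M / gcd d M\<close>, \<open>Q = m / p\<close> and
  \<open>w = z ^ d\<close>. Then \<open>y = w ^ Q\<close> is a primitive \<open>p\<close>-th root of unity, so that
  \<open>(y - 1) * (\<Sum>k<p. k * y ^ k) = p\<close>, and writing \<open>y - 1 = (w - 1) * (\<Sum>l<Q. w ^ l)\<close> gives
  \<open>(w - 1) * (\<Sum>e<m. (e div Q) * w ^ e) = p\<close>. The exponents \<open>d * e - j\<close> with \<open>e < m\<close> are distinct
  modulo \<open>M\<close>, hence \<open>u = (\<Sum>e<m. (e div Q) * x ^ (d * e - j))\<close> has coefficients in \<open>{0..p-1}\<close>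
  modulo \<open>x ^ M - 1\<close>. Reducing modulo \<open>\<Sum>k<p. x ^ (k * p ^ (s - 1))\<close> replaces each
  coefficient by a difference of two such coefficients.
\<close>

section \<open>Divisibility by the cyclotomic polynomial\<close>

lemma prod_linear_factors_dvd:
  fixes f :: "'a::idom poly"
  assumes "finite A" "\<And>z. z \<in> A \<Longrightarrow> poly f z = 0"
  shows "(\<Prod>z\<in>A. [:- z, 1:]) dvd f"
  using assms
proof (induction A)
  case (insert a A)
  then obtain g where g: "f = (\<Prod>z\<in>A. [:- z, 1:]) * g" by (auto elim!: dvdE)
  \<comment> \<open>The linear factors have distinct roots, so the root \<open>a\<close> of
    \<open>f\<close> must come from the cofactor \<open>g\<close>.\<close>
  have "poly (\<Prod>z\<in>A. [:- z, 1:]) a \<noteq> 0"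
    using insert.hyps by (auto simp: poly_prod)
  moreover have "poly f a = 0" using insert.prems by simp
  ultimately have "[:- a, 1:] dvd g" by (simp add: g poly_eq_0_iff_dvd)
  hence "[:- a, 1:] * (\<Prod>z\<in>A. [:- z, 1:]) dvd f"
    unfolding g mult.commute[of "[:- a, 1:]"] by (rule mult_dvd_mono[OF dvd_refl])
  thus ?case by (simp only: prod.insert[OF insert.hyps])
qed simp

text \<open>The complex cofactor is integral because the cyclotomic polynomial is monic. This
  reduces a congruence in the quotient ring to an identity at each primitive root.\<close>

lemma cyclotomic_dvdI:
  assumes "n > 0" "\<And>z. z \<in> primitive_roots_unity n \<Longrightarrow> poly (map_poly of_int f) z = 0"
  shows "cyclotomic n dvd f"
proof -
  have "map_poly of_int (cyclotomic n) dvd (map_poly of_int f :: complex poly)"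
    unfolding of_int_cyclotomic[OF assms(1)]
    by (rule prod_linear_factors_dvd[OF finite_primitive_roots_unity[OF assms(1)] assms(2)])
  then obtain C where C: "map_poly of_int f = map_poly of_int (cyclotomic n) * (C :: complex poly)"
    by (elim dvdE)
  then obtain g where "map_poly of_int g = C"
    using monic_dvd_of_int_poly cyclotomic_monic(1)[OF assms(1)] by blast
  with C have "f = cyclotomic n * g"
    by (simp flip: map_poly_of_int_inject add: map_poly_of_int_mult)
  thus ?thesis by simp
qed

section \<open>Residue classes and the norm\<close>

lemma residue_class_eqI:
  assumes "cyclotomic n dvd f - g"
  shows "residue_class n f = residue_class n g"
proof -
  have "cyclotomic n dvd h - f \<longleftrightarrow> cyclotomic n dvd h - g" for h
    using dvd_add_left_iff[OF assms, of "h - f"] by (simp add: algebra_simps)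
  thus ?thesis by (auto simp: mem_residue_class_iff)
qed

lemma residue_class_mult:
  "residue_class n f \<otimes>\<^bsub>cyclotomic_ring n\<^esub> residue_class n g = residue_class n (f * g)"
proof -
  interpret cring int_poly_ring by (rule cring_int_poly_ring)
  interpret ideal "cyclotomic_ideal n" int_poly_ring
    unfolding cyclotomic_ideal_def
    by (rule genideal_ideal) (simp add: int_poly_ring_def carrier_class)
  show ?thesis
    using rcoset_mult_add[of f g]
    by (simp add: cyclotomic_ring_def FactRing_def residue_class_def int_poly_ring_def
        carrier_class times_class)
qed

lemma inf_norm_residue_class_le:
  assumes "n > 0" "degree r < totient n" "\<And>k. k < totient n \<Longrightarrow> \<bar>coeff r k\<bar> \<le> B"
  shows "inf_norm n (residue_class n r) \<le> B"
proof -
  have "reduced_rep n (residue_class n r) = r"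
    unfolding reduced_rep_def
    by (rule the1_equality[OF ex1_reduced_rep])
       (use assms in \<open>auto simp: carrier_cyclotomic_ring mem_residue_class_iff\<close>)
  thus ?thesis using assms by (auto simp: inf_norm_def intro!: Max.boundedI)
qed

section \<open>Sums of powers of roots of unity\<close>

lemma primitive_roots_unity_power_eq_1:
  assumes "z \<in> primitive_roots_unity n" "n > 0" "z ^ k = 1"
  shows "n dvd k"
proof -
  have "z ^ k = (z ^ n) ^ (k div n) * z ^ (k mod n)"
    by (simp flip: power_add power_mult)
  hence "z ^ (k mod n) = 1" using assms by (simp add: primitive_roots_unity_def)
  moreover have "k mod n < n" using assms by simp
  ultimately show ?thesis using assms(1)
    by (auto simp: primitive_roots_unity_def dvd_eq_mod_eq_0)
qed

lemma sum_powers_root_unity: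
  fixes y :: "'a::field"
  assumes "y ^ n = 1" "y \<noteq> 1"
  shows "(\<Sum>k<n. y ^ k) = 0"
  using assms power_diff_1_eq[of y n] by simp

text \<open>Telescoping. The right side collapses to \<open>n\<close> once \<open>y ^ n = 1\<close>
  and the geometric sum vanishes.\<close>

lemma sum_weighted_powers:
  fixes y :: "'a::comm_ring_1"
  shows "(y - 1) * (\<Sum>k<n. of_nat k * y ^ k) = of_nat n * y ^ n - y * (\<Sum>k<n. y ^ k)"
  by (induction n) (simp_all add: algebra_simps)

lemma sum_lessThan_mult:
  fixes f :: "nat \<Rightarrow> 'a::comm_monoid_add"
  shows "sum f {..<n * q} = (\<Sum>k<n. \<Sum>l<q. f (k * q + l))"
proof -
  have "sum f {k * q..<k * q + q} = (\<Sum>l<q. f (k * q + l))" for k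
    using sum.shift_bounds_nat_ivl[of f 0 "k * q" q] by (simp add: lessThan_atLeast0 add.commute)
  thus ?thesis by (simp flip: sum.nat_group)
qed

text \<open>For \<open>e = k * q + l\<close> with \<open>l < q\<close> the weight is
  \<open>k\<close>, so the sum splits into a geometric sum in \<open>w\<close> and a weighted sum in
  \<open>w ^ q\<close>.\<close>

lemma sum_div_weighted_powers:
  fixes w :: "'a::field"
  assumes "w ^ (n * q) = 1" "w ^ q \<noteq> 1"
  shows "(w - 1) * (\<Sum>e<n * q. of_nat (e div q) * w ^ e) = of_nat n"
proof -
  have "(\<Sum>e<n * q. of_nat (e div q) * w ^ e)
      = (\<Sum>k<n. \<Sum>l<q. of_nat k * (w ^ q) ^ k * w ^ l)"
    unfolding sum_lessThan_mult
    by (intro sum.cong refl) (simp add: power_add power_mult mult.commute[of _ q])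
  also have "\<dots> = (\<Sum>l<q. w ^ l) * (\<Sum>k<n. of_nat k * (w ^ q) ^ k)"
    by (simp add: sum_distrib_left sum_distrib_right mult.commute)
  finally have "(w - 1) * (\<Sum>e<n * q. of_nat (e div q) * w ^ e)
      = (w ^ q - 1) * (\<Sum>k<n. of_nat k * (w ^ q) ^ k)"
    by (simp add: power_diff_1_eq mult.assoc)
  also have "\<dots> = of_nat n"
  proof -
    have "(w ^ q) ^ n = 1" using assms(1) by (simp add: mult.commute flip: power_mult)
    thus ?thesis
      unfolding sum_weighted_powers using assms(2) by (simp add: sum_powers_root_unity)
  qed
  finally show ?thesis .
qed

text \<open>The hypothesis rewrites \<open>z ^ (n * q + l)\<close> as minus the sum of
  \<open>z ^ (k * q + l)\<close> over \<open>k < n\<close>. The top block of \<open>q\<close>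
  coefficients is thus subtracted from every lower block.\<close>

lemma sum_powers_reduce:
  fixes z :: "'a::field" and c :: "nat \<Rightarrow> 'a"
  assumes "(\<Sum>k<Suc n. z ^ (k * q)) = 0"
  shows "(\<Sum>a<Suc n * q. c a * z ^ a) = (\<Sum>a<n * q. (c a - c (n * q + a mod q)) * z ^ a)"
proof -
  have "(\<Sum>a<n * q. c (n * q + a mod q) * z ^ a)
      = (\<Sum>k<n. \<Sum>l<q. z ^ (k * q) * (c (n * q + l) * z ^ l))"
    unfolding sum_lessThan_mult
    by (intro sum.cong refl) (simp add: power_add mult_ac)
  also have "\<dots> = (\<Sum>k<n. z ^ (k * q)) * (\<Sum>l<q. c (n * q + l) * z ^ l)"
    by (simp add: sum_product)
  also have "(\<Sum>k<n. z ^ (k * q)) = - (z ^ (n * q))"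
    using assms by (simp add: eq_neg_iff_add_eq_0)
  also have "- (z ^ (n * q)) * (\<Sum>l<q. c (n * q + l) * z ^ l)
      = - (\<Sum>l<q. c (n * q + l) * z ^ (n * q + l))"
    by (simp add: sum_distrib_left power_add mult_ac sum_negf)
  finally have "(\<Sum>a<n * q. c (n * q + a mod q) * z ^ a)
      = - (\<Sum>l<q. c (n * q + l) * z ^ (n * q + l))" .
  moreover have "(\<Sum>a<Suc n * q. c a * z ^ a)
      = (\<Sum>a<n * q. c a * z ^ a) + (\<Sum>l<q. c (n * q + l) * z ^ (n * q + l))"
    by (simp only: sum_lessThan_mult sum.lessThan_Suc)
  ultimately show ?thesis by (simp add: left_diff_distrib sum_subtractf)
qed

theorem theorem1:
  fixes p s M i j :: nat
  assumes "prime p" and "s > 0" and "M = p ^ s"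
    and "j < i" and "i < M"
  shows "\<exists>u \<in> carrier (cyclotomic_ring M).
    residue_class M (monom 1 i - monom 1 j) \<otimes>\<^bsub>cyclotomic_ring M\<^esub> u
      = residue_class M (of_nat p)
    \<and> inf_norm M u \<le> int p - 1"
proof -
  define d where "d = i - j"
  define m where "m = M div gcd d M"
  define Q where "Q = m div p"
  define q where "q = p ^ (s - 1)"
  define N where "N = (p - 1) * q"
  have p1: "p > 1" using assms(1) prime_gt_1_nat by blast
  have M0: "M > 0" and q0: "q > 0" using assms(3) p1 by (auto simp: q_def)
  have tot: "totient M = N"
    using assms(1-3) by (simp add: N_def q_def totient_prime_power mult.commute)
  have N0: "N > 0" using p1 q0 by (simp add: N_def)
  have Mq: "M = p * q"
    using assms(2,3) by (simp add: q_def power_eq_if)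
  have d: "0 < d" "d < M" using assms(4,5) by (auto simp: d_def)
  \<comment> \<open>In terms of a primitive \<open>M\<close>-th root of unity \<open>z\<close>: the
    order of \<open>z ^ d\<close> is \<open>m\<close>.\<close>
  have dvd_iff: "M dvd d * k \<longleftrightarrow> m dvd k" for k
  proof -
    obtain a b where ab: "d = a * gcd d M" "M = b * gcd d M" "coprime a b"
      using gcd_coprime_exists[of d M] d by auto
    have g0: "gcd d M > 0" using d by simp
    have "m = b" using ab(2) g0 unfolding m_def by (metis nonzero_mult_div_cancel_right less_irrefl)
    moreover have "M dvd d * k \<longleftrightarrow> b * gcd d M dvd (a * k) * gcd d M"
      using ab(1,2) by (metis mult.assoc mult.commute)
    ultimately show ?thesis
      using d ab(3) by (simp add: coprime_dvd_mult_right_iff coprime_commute)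
  qed
  have m_M: "m dvd M" by (simp flip: dvd_iff)
  have m0: "m > 0" using m_M M0 dvd_pos_nat by blast
  \<comment> \<open>\<open>m = 1\<close> would give \<open>M dvd d\<close>, against
    \<open>0 < d < M\<close>. A divisor of \<open>p ^ s\<close> other than 1 is a multiple of
    \<open>p\<close>.\<close>
  have "m \<noteq> 1" using dvd_iff[of 1] d by (auto dest: dvd_imp_le)
  hence "p dvd m"
    using m_M assms(1,3) divides_primepow_nat[of p m s] by (metis dvd_power not_gr0 power_0)
  hence mQ: "m = p * Q" by (simp add: Q_def)
  have Q0: "Q > 0" using mQ m0 by auto
  \<comment> \<open>The exponent \<open>d * e - j\<close> modulo \<open>M\<close>; adding
    \<open>M - j\<close> avoids truncated subtraction.\<close>
  define E where "E e = (d * e + (M - j)) mod M" for e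
  \<comment> \<open>Since \<open>E\<close> is injective below \<open>m\<close>, at most one summand
    occurs; exponents that \<open>E\<close> misses get coefficient 0.\<close>
  define c where "c n = (\<Sum>e\<in>{e. e < m \<and> E e = n}. int (e div Q))" for n
  have E_lt: "E e < M" for e using M0 by (simp add: E_def)
  have E_inj: "e = e'" if "e < m" "e' < m" "E e = E e'" for e e'
    using that
  proof (induction e e' rule: linorder_wlog)
    case (le a b)
    hence "M dvd (d * b + (M - j)) - (d * a + (M - j))"
      by (intro mod_eq_dvd_iff_nat[THEN iffD1]) (auto simp: E_def)
    hence "M dvd d * (b - a)" by (simp add: diff_mult_distrib2)
    hence "m dvd b - a" by (simp add: dvd_iff)
    thus ?case using le by (auto dest: dvd_imp_le)
  qed auto
  have c: "0 \<le> c n \<and> c n \<le> int p - 1" for n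
  proof (cases "\<exists>e<m. E e = n")
    case True
    then obtain e where e: "e < m" "E e = n" by blast
    hence "{e. e < m \<and> E e = n} = {e}" using E_inj by auto
    moreover have "e div Q < p" using e(1) by (simp add: mQ less_mult_imp_div_less)
    ultimately show ?thesis by (simp add: c_def)
  next
    case False
    hence "{e. e < m \<and> E e = n} = {}" by blast
    thus ?thesis using p1 by (simp only: c_def) simp
  qed
  \<comment> \<open>Since \<open>M = N + q\<close>, the exponents \<open>N + n mod q\<close> run
    through the top block, which is folded onto those below \<open>N\<close>.\<close>
  define R where "R = (\<Sum>n<N. monom (c n - c (N + n mod q)) n)"
  have coeff_R: "coeff R k = (if k < N then c k - c (N + k mod q) else 0)" for k
    by (simp add: R_def coeff_sum)
  have "degree R \<le> N - 1" by (rule degree_le) (use coeff_R in auto)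
  hence deg: "degree R < totient M" using N0 tot by simp
  have bound: "\<bar>coeff R k\<bar> \<le> int p - 1" for k
    \<comment> \<open>A difference of two numbers in \<open>{0..p-1}\<close> has absolute value at
      most \<open>p - 1\<close>.\<close>
    using c[of k] c[of "N + k mod q"] p1 by (auto simp: coeff_R)
  have "cyclotomic M dvd (monom 1 i - monom 1 j) * R - of_nat p"
  proof (rule cyclotomic_dvdI[OF M0])

    \<comment> \<open>Evaluation at a primitive root of unity\<close>
    fix z :: complex assume z: "z \<in> primitive_roots_unity M"
    have zM: "z ^ M = 1" using z by (simp add: primitive_roots_unity_def)
    note order = primitive_roots_unity_power_eq_1[OF z M0]
    have z_mod: "z ^ (k mod M) = z ^ k" for k
    proof -
      have "z ^ k = (z ^ M) ^ (k div M) * z ^ (k mod M)" by (simp flip: power_add power_mult)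
      thus ?thesis using zM by simp
    qed
    have "(\<Sum>k<p. (z ^ q) ^ k) = 0"
    proof (rule sum_powers_root_unity)
      show "(z ^ q) ^ p = 1" using zM by (simp add: Mq mult.commute flip: power_mult)
      show "z ^ q \<noteq> 1" using order[of q] p1 q0 by (auto simp: Mq dest: dvd_imp_le)
    qed
    hence cyc: "(\<Sum>k<Suc (p - 1). z ^ (k * q)) = 0"
      using p1 by (simp add: mult.commute flip: power_mult)
    have Mq': "M = Suc (p - 1) * q" using Mq p1 by simp
    have "poly (map_poly of_int R) z = (\<Sum>n<N. of_int (c n - c (N + n mod q)) * z ^ n)"
    proof -
      have "map_poly of_int R = (\<Sum>n<N. monom (of_int (c n - c (N + n mod q))) n :: complex poly)"
        by (rule poly_eqI) (simp add: coeff_map_poly coeff_R coeff_sum)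
      thus ?thesis by (simp add: poly_sum poly_monom)
    qed
    also have "\<dots> = (\<Sum>n<M. of_int (c n) * z ^ n)"
      unfolding Mq' sum_powers_reduce[OF cyc, of "\<lambda>n. of_int (c n)"] by (simp add: N_def)
    \<comment> \<open>Unfolding \<open>c\<close> groups the indices \<open>e\<close> by the value of
      \<open>E e\<close>; the next step ungroups them.\<close>
    also have "\<dots> = (\<Sum>n<M. \<Sum>e\<in>{e\<in>{..<m}. E e = n}. of_nat (e div Q) * z ^ E e)"
      by (intro sum.cong refl) (simp add: c_def sum_distrib_right)
    also have "\<dots> = (\<Sum>e<m. of_nat (e div Q) * z ^ E e)"
      by (rule sum.group) (use E_lt in auto)
    finally have R: "poly (map_poly of_int R) z = (\<Sum>e<m. of_nat (e div Q) * z ^ E e)" .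
    \<comment> \<open>The factor \<open>z ^ j\<close> from
      \<open>z ^ i - z ^ j = z ^ j * (z ^ d - 1)\<close> cancels the shift by \<open>- j\<close> in
      \<open>E\<close>.\<close>
    have zE: "z ^ j * z ^ E e = (z ^ d) ^ e" for e
    proof -
      have "z ^ j * z ^ E e = z ^ (M + d * e)"
        using assms(4,5) by (simp add: E_def z_mod add.commute flip: power_add)
      thus ?thesis using zM by (simp add: power_add power_mult)
    qed
    have "(z ^ i - z ^ j) * poly (map_poly of_int R) z
        = (z ^ d - 1) * (z ^ j * poly (map_poly of_int R) z)"
      using assms(4) by (simp add: d_def algebra_simps flip: power_add)
    also have "z ^ j * poly (map_poly of_int R) z = (\<Sum>e<p * Q. of_nat (e div Q) * (z ^ d) ^ e)"
      by (simp add: R sum_distrib_left mQ flip: zE) (simp add: mult_ac)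
    also have "(z ^ d - 1) * \<dots> = of_nat p"
    proof (rule sum_div_weighted_powers)
      obtain k where "d * m = M * k" using dvd_iff[of m] by (auto elim: dvdE)
      hence "(z ^ d) ^ m = (z ^ M) ^ k" by (simp flip: power_mult)
      thus "(z ^ d) ^ (p * Q) = 1" using zM by (simp add: mQ)
      show "(z ^ d) ^ Q \<noteq> 1"
      proof
        assume "(z ^ d) ^ Q = 1"
        \<comment> \<open>Impossible, as \<open>0 < Q < p * Q = m\<close>.\<close>
        hence "m dvd Q" using order[of "d * Q"] by (simp add: dvd_iff power_mult)
        thus False using p1 Q0 by (auto simp: mQ dest: dvd_imp_le)
      qed
    qed
    finally have "(z ^ i - z ^ j) * poly (map_poly of_int R) z = of_nat p" .
    moreover have "map_poly of_int ((monom 1 i - monom 1 j) * R - of_nat p)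
        = (monom 1 i - monom 1 j) * map_poly of_int R - (of_nat p :: complex poly)"
    proof -
      have diff: "map_poly of_int (f - g) = map_poly of_int f - (map_poly of_int g :: complex poly)"
        for f g by (rule poly_eqI) (simp add: coeff_map_poly)
      have "map_poly of_int (of_nat p) = (of_nat p :: complex poly)"
        by (rule poly_eqI) (simp add: coeff_map_poly of_nat_poly coeff_pCons split: nat.splits)
      thus ?thesis by (simp add: diff map_poly_of_int_mult map_poly_monom)
    qed
    ultimately show "poly (map_poly of_int ((monom 1 i - monom 1 j) * R - of_nat p)) z = 0"
      by (simp add: poly_monom of_nat_poly)
  qed
  hence "residue_class M (monom 1 i - monom 1 j) \<otimes>\<^bsub>cyclotomic_ring M\<^esub> residue_class M R
      = residue_class M (of_nat p)"
    by (simp add: residue_class_mult residue_class_eqI)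
  moreover have "inf_norm M (residue_class M R) \<le> int p - 1"
    by (rule inf_norm_residue_class_le[OF M0 deg bound])
  ultimately show ?thesis by (auto simp: carrier_cyclotomic_ring)
qed

end
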